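(* Let $(\Gamma,\preceq)$ be an ordered group. If the Conradian soul of $(\Gamma,\preceq)$ is trivial and $\preceq$ is not Conradian, then $\preceq$ may be approximated by its conjugates.
   Context: An ordered group $(\Gamma,\preceq)$ is a group (possibly uncountable) with a total order relation (an ordering) invariant under left multiplication. The ordering is Conradian if for all $f\succ1$ and $g\succ 1$ there exists $n\in\mathbb{N}$ (positive integers) such that $fg^n\succ g$. A subgroup is $\preceq$-Conradian if the restriction of $\preceq$ to it is Conradian. A subset $T\subseteq\Gamma$ is $\preceq$-convex if whenever $f_1\prec f\prec f_2$ with $f_1,f_2\in T$ and $f\in\Gamma$, then $f\in T$. The Conradian soul $C_{\preceq}(\Gamma)$ is the (unique) subgroup which is $\preceq$-convex, $\preceq$-Conradian, and maximal among subgroups having these two properties simultaneously. $\mathcal{LO}(\Gamma)$ denotes the set of all orderings on $\Gamma$, with the topology having as a subbasis the sets $U_f=\{\preceq\,:\, f\succ 1\}$ for $f\in\Gamma$, $f\neq 1$. The positive cone of $\preceq$ is $P=\{g: g\succ 1\}$; it determines $\preceq$. The conjugates of $\preceq$ are the orderings with positive cones $hPh^{-1}$, $h\in\Gamma$. One says that $\preceq$ may be approximated by its conjugates if it is an accumulation point in $\mathcal{LO}(\Gamma)$ of its set of conjugates, i.e. every neighborhood of $\preceq$ contains a conjugate of $\preceq$ different from $\preceq$. *)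

theory Defs
  imports "HOL-Algebra.Coset" "HOL-Analysis.Abstract_Topology"
begin

text \<open>Orderings are relations \<open>r\<close> on \<open>carrier G\<close>, with \<open>(f, g) \<in> r\<close> meaning \<open>f \<preceq> g\<close> and
  \<open>(f, g) \<in> r - Id\<close> meaning \<open>f \<prec> g\<close>. Only left invariance is required, and \<open>linear_order_on\<close>
  includes \<open>r \<subseteq> carrier G \<times> carrier G\<close>, so orderings are equal as relations iff they agree on
  the group.\<close>

definition left_orderings :: "('a, 'b) monoid_scheme \<Rightarrow> 'a rel set" where
  "left_orderings G = {r. linear_order_on (carrier G) r \<and>
     (\<forall>h\<in>carrier G. \<forall>f g. (f, g) \<in> r \<longrightarrow> (h \<otimes>\<^bsub>G\<^esub> f, h \<otimes>\<^bsub>G\<^esub> g) \<in> r)}"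

locale ordered_group = group G for G (structure) +
  fixes r :: "'a rel"
  assumes ordering: "r \<in> left_orderings G"

definition positive_cone :: "('a, 'b) monoid_scheme \<Rightarrow> 'a rel \<Rightarrow> 'a set" where
  "positive_cone G r = {g. (\<one>\<^bsub>G\<^esub>, g) \<in> r - Id}"

definition conradian :: "('a, 'b) monoid_scheme \<Rightarrow> 'a rel \<Rightarrow> bool" where
  "conradian G r \<longleftrightarrow> (\<forall>f\<in>positive_cone G r. \<forall>g\<in>positive_cone G r.
     \<exists>n::nat. n \<ge> 1 \<and> (g, f \<otimes>\<^bsub>G\<^esub> g [^]\<^bsub>G\<^esub> n) \<in> r - Id)"

definition conradian_subgroup :: "('a, 'b) monoid_scheme \<Rightarrow> 'a rel \<Rightarrow> 'a set \<Rightarrow> bool" where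
  "conradian_subgroup G r H \<longleftrightarrow>
     subgroup H G \<and> conradian (G\<lparr>carrier := H\<rparr>) (r \<inter> H \<times> H)"

definition order_convex :: "('a, 'b) monoid_scheme \<Rightarrow> 'a rel \<Rightarrow> 'a set \<Rightarrow> bool" where
  "order_convex G r T \<longleftrightarrow> T \<subseteq> carrier G \<and>
     (\<forall>f\<^sub>1\<in>T. \<forall>f\<^sub>2\<in>T. \<forall>f\<in>carrier G. (f\<^sub>1, f) \<in> r - Id \<and> (f, f\<^sub>2) \<in> r - Id \<longrightarrow> f \<in> T)"

definition is_conradian_soul :: "('a, 'b) monoid_scheme \<Rightarrow> 'a rel \<Rightarrow> 'a set \<Rightarrow> bool" where
  "is_conradian_soul G r C \<longleftrightarrow> conradian_subgroup G r C \<and> order_convex G r C \<and>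
     (\<forall>D. conradian_subgroup G r D \<and> order_convex G r D \<and> C \<subseteq> D \<longrightarrow> D = C)"

text \<open>Existence and uniqueness are shown in \<open>ordered_group.ex1_conradian_soul\<close> below.\<close>

definition conradian_soul :: "('a, 'b) monoid_scheme \<Rightarrow> 'a rel \<Rightarrow> 'a set" where
  "conradian_soul G r = (THE C. is_conradian_soul G r C)"

text \<open>\<open>topology_generated_by\<close> has no empty intersection, so the whole space is added to the
  subbasis; this only matters for the trivial group, where there are no sets \<open>U\<^sub>f\<close>.\<close>

definition LO_topology :: "('a, 'b) monoid_scheme \<Rightarrow> 'a rel topology" where
  "LO_topology G = topology_generated_by (insert (left_orderings G)
     ((\<lambda>f. {s \<in> left_orderings G. f \<in> positive_cone G s}) ` (carrier G - {\<one>\<^bsub>G\<^esub>})))"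

definition conjugates :: "('a, 'b) monoid_scheme \<Rightarrow> 'a rel \<Rightarrow> 'a rel set" where
  "conjugates G r = {s \<in> left_orderings G. \<exists>h\<in>carrier G.
     positive_cone G s = (h <#\<^bsub>G\<^esub> positive_cone G r) #>\<^bsub>G\<^esub> (inv\<^bsub>G\<^esub> h)}"

lemma topspace_LO_topology: "topspace (LO_topology G) = left_orderings G"
  unfolding LO_topology_def by auto

context ordered_group
begin

lemma order_facts:
  shows r_carrier: "(f, g) \<in> r \<Longrightarrow> f \<in> carrier G \<and> g \<in> carrier G"
    and r_refl: "f \<in> carrier G \<Longrightarrow> (f, f) \<in> r"
    and r_trans: "(f, g) \<in> r \<Longrightarrow> (g, h) \<in> r \<Longrightarrow> (f, h) \<in> r"
    and r_antisym: "(f, g) \<in> r \<Longrightarrow> (g, f) \<in> r \<Longrightarrow> f = g"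
    and r_total: "f \<in> carrier G \<Longrightarrow> g \<in> carrier G \<Longrightarrow> (f, g) \<in> r \<or> (g, f) \<in> r"
    and r_left: "h \<in> carrier G \<Longrightarrow> (f, g) \<in> r \<Longrightarrow> (h \<otimes> f, h \<otimes> g) \<in> r"
proof -
  have o: "r \<subseteq> carrier G \<times> carrier G" "refl_on (carrier G) r" "trans r" "antisym r"
    "total_on (carrier G) r"
    using ordering by (auto simp: left_orderings_def order_on_defs)
  show "(f, g) \<in> r \<Longrightarrow> f \<in> carrier G \<and> g \<in> carrier G" using o(1) by auto
  show refl: "f \<in> carrier G \<Longrightarrow> (f, f) \<in> r" for f using o(2) by (simp add: refl_on_def)
  show "(f, g) \<in> r \<Longrightarrow> (g, h) \<in> r \<Longrightarrow> (f, h) \<in> r" using o(3) by (rule transD)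
  show "(f, g) \<in> r \<Longrightarrow> (g, f) \<in> r \<Longrightarrow> f = g" using o(4) by (rule antisymD)
  show "f \<in> carrier G \<Longrightarrow> g \<in> carrier G \<Longrightarrow> (f, g) \<in> r \<or> (g, f) \<in> r"
    using o(5) refl unfolding total_on_def by (cases "f = g") auto
  show "h \<in> carrier G \<Longrightarrow> (f, g) \<in> r \<Longrightarrow> (h \<otimes> f, h \<otimes> g) \<in> r"
    using ordering unfolding left_orderings_def by simp
qed

lemma positive_or_inv:
  assumes "f \<in> carrier G" "f \<noteq> \<one>"
  shows "(\<one>, f) \<in> r \<or> (\<one>, inv f) \<in> r"
proof (cases "(\<one>, f) \<in> r")
  case False
  then have "(f, \<one>) \<in> r" using r_total assms by blast
  from r_left[OF inv_closed[OF assms(1)] this] show ?thesis using assms by simp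
qed simp

lemma convex_subgroups_chain:
  assumes "subgroup H G" "order_convex G r H" "subgroup K G" "order_convex G r K"
  shows "H \<subseteq> K \<or> K \<subseteq> H"
proof (rule ccontr)
  have pos: "\<exists>f. f \<in> A - B \<and> (\<one>, f) \<in> r - Id"
    if AB: "subgroup A G" "subgroup B G" "\<not> A \<subseteq> B" for A B
  proof -
    obtain f where f: "f \<in> A" "f \<notin> B" using AB by blast
    have fc: "f \<in> carrier G" using f AB subgroup.mem_carrier by metis
    have f1: "f \<noteq> \<one>" using f AB subgroup.one_closed by metis
    have "inv f \<in> A" using f AB subgroup.m_inv_closed by metis
    moreover have "inv f \<notin> B"
      using f AB fc subgroup.m_inv_closed inv_inv by metis
    moreover have "inv f \<noteq> \<one>" using f1 fc inv_eq_1_iff by metis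
    ultimately show ?thesis using positive_or_inv[OF fc f1] f f1 by auto
  qed
  assume "\<not> ?thesis"
  then obtain h k where h: "h \<in> H - K" "(\<one>, h) \<in> r - Id" and k: "k \<in> K - H" "(\<one>, k) \<in> r - Id"
    using pos assms by meson
  have hk: "h \<noteq> k" "h \<in> carrier G" "k \<in> carrier G" using h k r_carrier by auto
  have one: "\<one> \<in> H" "\<one> \<in> K" using assms subgroup.one_closed by auto
  from r_total[OF hk(2,3)] show False
  proof
    assume "(h, k) \<in> r"
    then have "h \<in> K" using assms(4) one h k hk unfolding order_convex_def by blast
    then show False using h by simp
  next
    assume "(k, h) \<in> r"
    then have "k \<in> H" using assms(2) one h k hk unfolding order_convex_def by blast
    then show False using k by simp
  qed
qed

lemma conradian_subgroup_iff:
  "conradian_subgroup G r H \<longleftrightarrow> subgroup H G \<and>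
     (\<forall>f\<in>H. \<forall>g\<in>H. (\<one>, f) \<in> r - Id \<longrightarrow> (\<one>, g) \<in> r - Id \<longrightarrow>
        (\<exists>n::nat. n \<ge> 1 \<and> (g, f \<otimes> g [^] n) \<in> r - Id))"
proof (cases "subgroup H G")
  case True
  interpret H: subgroup H G by (rule True)
  have pow: "g [^]\<^bsub>G\<lparr>carrier := H\<rparr>\<^esub> n = g [^] n" for g and n :: nat
    by (simp add: nat_pow_def)
  have "g [^] n \<in> H" if "g \<in> H" for g and n :: nat
    using that by (induction n) auto
  then show ?thesis
    unfolding conradian_subgroup_def conradian_def positive_cone_def pow
    using True by auto
qed (simp add: conradian_subgroup_def)

lemma ex1_conradian_soul: "\<exists>!C. is_conradian_soul G r C"
proof -
  define F where "F = {H. conradian_subgroup G r H \<and> order_convex G r H}"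
  define U where "U = \<Union>F"
  have sub: "subgroup H G" if "H \<in> F" for H
    using that unfolding F_def conradian_subgroup_def by simp
  have triv: "{\<one>} \<in> F"
    using triv_subgroup r_antisym unfolding F_def conradian_subgroup_iff order_convex_def by auto
  have common: "\<exists>H\<in>F. f \<in> H \<and> g \<in> H" if fg: "f \<in> U" "g \<in> U" for f g
  proof -
    obtain H K where HK: "H \<in> F" "f \<in> H" "K \<in> F" "g \<in> K" using fg unfolding U_def by blast
    then have "H \<subseteq> K \<or> K \<subseteq> H"
      using convex_subgroups_chain sub unfolding F_def by blast
    then show ?thesis using HK by blast
  qed
  have subU: "subgroup U G"
  proof (rule subgroupI)
    show "U \<subseteq> carrier G" using sub subgroup.subset unfolding U_def by blast
    show "U \<noteq> {}" using triv unfolding U_def by blast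
    show "inv a \<in> U" if "a \<in> U" for a
      using that sub subgroup.m_inv_closed unfolding U_def by (metis Union_iff)
    show "a \<otimes> b \<in> U" if "a \<in> U" "b \<in> U" for a b
      using common[OF that] sub subgroup.m_closed unfolding U_def by (metis Union_iff)
  qed
  have "order_convex G r U"
    unfolding order_convex_def
  proof (intro conjI ballI impI)
    show "U \<subseteq> carrier G" using subU subgroup.subset by blast
    fix f\<^sub>1 f\<^sub>2 f assume a: "f\<^sub>1 \<in> U" "f\<^sub>2 \<in> U" "f \<in> carrier G" "(f\<^sub>1, f) \<in> r - Id \<and> (f, f\<^sub>2) \<in> r - Id"
    obtain H where "H \<in> F" "f\<^sub>1 \<in> H" "f\<^sub>2 \<in> H" using common a by blast
    then have "f \<in> H" using a unfolding F_def order_convex_def by blast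
    then show "f \<in> U" using \<open>H \<in> F\<close> unfolding U_def by blast
  qed
  moreover have "conradian_subgroup G r U"
    unfolding conradian_subgroup_iff
  proof (intro conjI ballI impI subU)
    fix f g assume a: "f \<in> U" "g \<in> U" "(\<one>, f) \<in> r - Id" "(\<one>, g) \<in> r - Id"
    obtain H where "H \<in> F" "f \<in> H" "g \<in> H" using common a by blast
    then show "\<exists>n::nat. n \<ge> 1 \<and> (g, f \<otimes> g [^] n) \<in> r - Id"
      using a unfolding F_def conradian_subgroup_iff by blast
  qed
  ultimately have UF: "U \<in> F" unfolding F_def by simp
  have soul: "is_conradian_soul G r C \<longleftrightarrow> C \<in> F \<and> (\<forall>D\<in>F. C \<subseteq> D \<longrightarrow> D = C)" for C
    unfolding is_conradian_soul_def F_def by blast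
  have "H \<subseteq> U" if "H \<in> F" for H using that unfolding U_def by blast
  then show ?thesis unfolding soul using UF by (intro ex1I[of _ U]) blast+
qed

lemma is_conradian_soul_conradian_soul: "is_conradian_soul G r (conradian_soul G r)"
  unfolding conradian_soul_def by (rule theI'[OF ex1_conradian_soul])

lemma ex_conjugate:
  assumes h: "h \<in> carrier G"
  shows "\<exists>s\<in>left_orderings G. positive_cone G s = (h <# positive_cone G r) #> inv h"
proof
  let ?s = "{(f, g). f \<in> carrier G \<and> g \<in> carrier G \<and> (f \<otimes> h, g \<otimes> h) \<in> r}"
  have "linear_order_on (carrier G) ?s"
    unfolding order_on_defs
  proof (intro conjI)
    show "?s \<subseteq> carrier G \<times> carrier G" by auto
    show "refl_on (carrier G) ?s" using h r_refl by (simp add: refl_on_def)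
    show "trans ?s" 
    proof (rule transI)
      fix f g k assume "(f, g) \<in> ?s" "(g, k) \<in> ?s"
      then show "(f, k) \<in> ?s" using r_trans[of "f \<otimes> h" "g \<otimes> h" "k \<otimes> h"] by simp
    qed
    show "antisym ?s"
    proof (rule antisymI)
      fix f g assume "(f, g) \<in> ?s" "(g, f) \<in> ?s"
      then have "f \<otimes> h = g \<otimes> h" "f \<in> carrier G" "g \<in> carrier G" using r_antisym by simp_all
      then show "f = g" using h by simp
    qed
    show "total_on (carrier G) ?s" using h r_total by (simp add: total_on_def)
  qed
  moreover have "(k \<otimes> f, k \<otimes> g) \<in> ?s" if "k \<in> carrier G" "(f, g) \<in> ?s" for k f g
    using that h r_left[of k "f \<otimes> h" "g \<otimes> h"] by (simp add: m_assoc)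
  ultimately show "?s \<in> left_orderings G" unfolding left_orderings_def by blast
  show "positive_cone G ?s = (h <# positive_cone G r) #> inv h"
  proof (intro equalityI subsetI)
    fix g assume "g \<in> positive_cone G ?s"
    then have g: "g \<in> carrier G" "g \<noteq> \<one>" "(h, g \<otimes> h) \<in> r"
      using h unfolding positive_cone_def by auto
    let ?p = "inv h \<otimes> (g \<otimes> h)"
    have "(\<one>, ?p) \<in> r" using r_left[OF inv_closed[OF h] g(3)] h by simp
    moreover have eq: "g = h \<otimes> ?p \<otimes> inv h"
    proof -
      have "h \<otimes> ?p = h \<otimes> inv h \<otimes> (g \<otimes> h)" using h g(1) by (simp only: m_assoc m_closed inv_closed)
      also have "\<dots> = g \<otimes> h" using h g(1) by (simp only: r_inv l_one m_closed)
      finally have "h \<otimes> ?p \<otimes> inv h = g \<otimes> h \<otimes> inv h" by (rule arg_cong)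
      also have "\<dots> = g" using h g(1) by (simp only: m_assoc r_inv r_one inv_closed)
      finally show ?thesis by (rule sym)
    qed
    moreover have "?p \<noteq> \<one>"
    proof
      assume "?p = \<one>"
      then have "g = h \<otimes> \<one> \<otimes> inv h" using eq by metis
      also have "\<dots> = \<one>" using h by simp
      finally show False using g(2) by simp
    qed
    ultimately have "?p \<in> positive_cone G r" unfolding positive_cone_def by simp
    then have "h \<otimes> ?p \<in> h <# positive_cone G r" unfolding l_coset_def by auto
    then have "h \<otimes> ?p \<otimes> inv h \<in> (h <# positive_cone G r) #> inv h"
      unfolding r_coset_def by auto
    then show "g \<in> (h <# positive_cone G r) #> inv h" using eq by metis
  next
    fix g assume "g \<in> (h <# positive_cone G r) #> inv h"
    then obtain p where p: "(\<one>, p) \<in> r" "p \<noteq> \<one>" "g = h \<otimes> p \<otimes> inv h"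
      unfolding l_coset_def r_coset_def positive_cone_def by auto
    have pc: "p \<in> carrier G" using p r_carrier by blast
    have gh: "g \<otimes> h = h \<otimes> p" using p pc h by (simp add: m_assoc)
    have "g \<noteq> \<one>"
    proof
      assume "g = \<one>"
      then have "h \<otimes> p = h" using gh h by simp
      then show False using p pc h by simp
    qed
    moreover have "g \<in> carrier G" using p pc h by simp
    ultimately show "g \<in> positive_cone G ?s"
      using r_left[OF h p(1)] gh h unfolding positive_cone_def by auto
  qed
qed

end

end

theory Submission
  imports Defs "HOL-Algebra.Generated_Groups"
begin

text \<open>Call a subgroup \<open>T\<close> \<^emph>\<open>tame\<close> here if \<open>f \<otimes> g \<succ> g\<close> for all positive \<open>f, g \<in> T\<close>; its ordering is
  then Conradian with \<open>n = 1\<close>. The elements \<open>h\<close> of a tame \<open>T\<close> such that \<open>T\<close> contains everything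
  between \<open>\<one>\<close> and \<open>h\<close> form a convex subgroup, again tame, so a trivial Conradian soul forces
  this convex subgroup to be trivial: next to \<open>\<one>\<close>, a tame subgroup has gaps (\<open>gap_of_trivial_soul\<close>).

  Every neighbourhood of \<open>\<preceq>\<close> contains, for some \<open>c \<succ> \<one>\<close>, all orderings making every \<open>f \<succeq> c\<close>
  positive (\<open>LO_neighbourhood\<close>): take for \<open>c\<close> the least of the finitely many elements whose
  positivity defines a basic neighbourhood. If \<open>\<one> \<preceq> h \<prec> c \<preceq> f\<close>, then \<open>f \<otimes> h \<succeq> f \<succ> h\<close>, which says
  that \<open>f\<close> is positive for the conjugate of \<open>\<preceq>\<close> by \<open>h\<close>. Hence all conjugates by such
  \<open>h\<close> lie in the neighbourhood, and it remains to find one that differs from \<open>\<preceq>\<close>, that is, an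
  \<open>h\<close> outside the stabilizer of \<open>\<preceq>\<close> under conjugation. The stabilizer is tame, since \<open>\<preceq>\<close> is
  bi-invariant on it. If some \<open>d\<close> lies strictly between \<open>\<one>\<close> and \<open>c\<close>, the stabilizer therefore has
  a gap between \<open>\<one>\<close> and \<open>d\<close>, which provides \<open>h\<close>. There is always such a \<open>d\<close>: otherwise \<open>c\<close> is
  the least positive element, and the cyclic subgroup it generates is tame, being abelian, but has
  no gap between \<open>\<one>\<close> and \<open>c\<close>.

  The failure of the Conradian property makes the group nontrivial, and so provides the positive
  element \<open>c\<close> for the neighbourhood that is the whole space.\<close>

context ordered_group
begin

section \<open>Convex subgroups and gaps\<close>

definition between :: "'a \<Rightarrow> 'a \<Rightarrow> 'a \<Rightarrow> bool" where
  "between p q x \<longleftrightarrow> (p, x) \<in> r \<and> (x, q) \<in> r \<or> (q, x) \<in> r \<and> (x, p) \<in> r"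

definition convex_core :: "'a set \<Rightarrow> 'a set" where
  "convex_core T = {h \<in> carrier G. \<forall>x. between \<one> h x \<longrightarrow> x \<in> T}"

lemma r_strict_trans: "(f, g) \<in> r - Id \<Longrightarrow> (g, h) \<in> r \<Longrightarrow> (f, h) \<in> r - Id"
  using r_trans[of f g h] r_antisym[of f g] by auto

lemma r_left_iff:
  assumes "h \<in> carrier G" "f \<in> carrier G" "g \<in> carrier G"
  shows "(h \<otimes> f, h \<otimes> g) \<in> r \<longleftrightarrow> (f, g) \<in> r"
proof
  assume "(h \<otimes> f, h \<otimes> g) \<in> r"
  from r_left[OF inv_closed[OF assms(1)] this] show "(f, g) \<in> r"
    using assms by (simp add: m_assoc[symmetric])
qed (use assms r_left in blast)

lemma between_carrier: "between p q x \<Longrightarrow> p \<in> carrier G \<and> q \<in> carrier G \<and> x \<in> carrier G"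
  using r_carrier unfolding between_def by blast

lemma between_positive:
  assumes "(\<one>, q) \<in> r" "between \<one> q x"
  shows "(\<one>, x) \<in> r \<and> (x, q) \<in> r"
  using assms r_antisym[of q x] r_trans[of q x \<one>] r_antisym[of \<one> q]
    r_refl between_carrier[of \<one> q x]
  unfolding between_def by auto

lemma between_left: "k \<in> carrier G \<Longrightarrow> between p q x \<Longrightarrow> between (k \<otimes> p) (k \<otimes> q) (k \<otimes> x)"
  unfolding between_def using r_left by blast

lemma between_split:
  assumes "between p q x" "m \<in> carrier G"
  shows "between p m x \<or> between m q x"
  using assms between_carrier[OF assms(1)] r_total[of m x] unfolding between_def by blast

lemma convex_core_subset: "convex_core T \<subseteq> T"
proof
  fix h assume h: "h \<in> convex_core T"
  then have "h \<in> carrier G" unfolding convex_core_def by simp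
  then have "between \<one> h h" using r_total r_refl unfolding between_def by blast
  then show "h \<in> T" using h unfolding convex_core_def by blast
qed

lemma subgroup_convex_core:
  assumes "subgroup T G"
  shows "subgroup (convex_core T) G"
proof (rule subgroupI)
  interpret T: subgroup T G by (rule assms)
  show "convex_core T \<subseteq> carrier G" unfolding convex_core_def by blast
  have "x \<in> T" if "between \<one> \<one> x" for x
    using that r_antisym[of x \<one>] T.one_closed unfolding between_def by auto
  then have "\<one> \<in> convex_core T" unfolding convex_core_def by simp
  then show "convex_core T \<noteq> {}" by blast
  fix a assume a: "a \<in> convex_core T"
  have aT: "a \<in> T" using a convex_core_subset by blast
  have ac: "a \<in> carrier G" using aT by simp
  show "inv a \<in> convex_core T"
  proof -
    have "x \<in> T" if x: "between \<one> (inv a) x" for x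
    proof -
      have xc: "x \<in> carrier G" using between_carrier[OF x] by blast
      \<comment> \<open>Translation by \<open>a\<close> carries the interval from \<open>inv a\<close> to \<open>\<one>\<close> onto the one from \<open>\<one>\<close> to \<open>a\<close>.\<close>
      have "between a \<one> (a \<otimes> x)" using between_left[OF ac x] ac by simp
      then have "a \<otimes> x \<in> T" using a unfolding convex_core_def between_def by blast
      then have "inv a \<otimes> (a \<otimes> x) \<in> T" using aT by simp
      then show ?thesis using ac xc by (simp add: m_assoc[symmetric])
    qed
    then show ?thesis using ac unfolding convex_core_def by simp
  qed
  fix b assume b: "b \<in> convex_core T"
  have bc: "b \<in> carrier G" using b unfolding convex_core_def by simp
  have "x \<in> T" if x: "between \<one> (a \<otimes> b) x" for x
  proof -
    have xc: "x \<in> carrier G" using between_carrier[OF x] by blast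
    from between_split[OF x ac] show ?thesis
    proof
      assume "between \<one> a x"
      then show ?thesis using a unfolding convex_core_def by blast
    next
      assume "between a (a \<otimes> b) x"
      from between_left[OF inv_closed[OF ac] this] have "between \<one> b (inv a \<otimes> x)"
        using ac bc by (simp add: m_assoc[symmetric])
      then have "inv a \<otimes> x \<in> T" using b unfolding convex_core_def by blast
      then have "a \<otimes> (inv a \<otimes> x) \<in> T" using aT by simp
      then show ?thesis using ac xc by (simp add: m_assoc[symmetric])
    qed
  qed
  then show "a \<otimes> b \<in> convex_core T" using ac bc unfolding convex_core_def by simp
qed

lemma order_convex_convex_core: "order_convex G r (convex_core T)"
  unfolding order_convex_def
proof (intro conjI ballI impI)
  show "convex_core T \<subseteq> carrier G" unfolding convex_core_def by blast
  fix f1 f2 f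
  assume a: "f1 \<in> convex_core T" "f2 \<in> convex_core T" "f \<in> carrier G"
    "(f1, f) \<in> r - Id \<and> (f, f2) \<in> r - Id"
  have "between \<one> f1 x \<or> between \<one> f2 x" if "between \<one> f x" for x
    using that a(4) r_trans[of f1 f x] r_trans[of x f f2] unfolding between_def by blast
  then show "f \<in> convex_core T" using a unfolding convex_core_def by blast
qed

text \<open>The convex core of \<open>T\<close> is a convex subgroup, and Conradian because it inherits \<open>tame\<close> from
  \<open>T\<close>. By maximality of the soul \<open>{\<one>}\<close> it contains no \<open>h \<noteq> \<one>\<close>.\<close>

lemma gap_of_trivial_soul:
  assumes soul: "conradian_soul G r = {\<one>}"
    and T: "subgroup T G"
    and tame: "\<And>f g. f \<in> T \<Longrightarrow> g \<in> T \<Longrightarrow> (\<one>, f) \<in> r - Id \<Longrightarrow> (\<one>, g) \<in> r - Id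
                 \<Longrightarrow> (g, f \<otimes> g) \<in> r - Id"
    and h: "h \<in> carrier G" "h \<noteq> \<one>"
  shows "\<exists>x. between \<one> h x \<and> x \<notin> T"
proof (rule ccontr)
  let ?D = "convex_core T"
  assume "\<not> ?thesis"
  then have hD: "h \<in> ?D" using h unfolding convex_core_def by blast
  have "\<exists>n::nat. n \<ge> 1 \<and> (g, f \<otimes> g [^] n) \<in> r - Id"
    if "f \<in> ?D" "g \<in> ?D" "(\<one>, f) \<in> r - Id" "(\<one>, g) \<in> r - Id" for f g
  proof -
    have "g \<in> carrier G" using that unfolding convex_core_def by blast
    then have "(g, f \<otimes> g [^] (1::nat)) \<in> r - Id"
      using tame[of f g] that convex_core_subset by auto
    then show ?thesis by blast
  qed
  then have "conradian_subgroup G r ?D"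
    unfolding conradian_subgroup_iff using subgroup_convex_core[OF T] by blast
  moreover have "\<one> \<in> ?D" using subgroup_convex_core[OF T] by (rule subgroup.one_closed)
  ultimately have "?D = {\<one>}"
    using is_conradian_soul_conradian_soul order_convex_convex_core
    unfolding soul is_conradian_soul_def by simp
  then show False using hD h by blast
qed

lemma no_least_positive:
  assumes soul: "conradian_soul G r = {\<one>}" and c: "(\<one>, c) \<in> r - Id"
  shows "\<exists>d. (\<one>, d) \<in> r - Id \<and> (d, c) \<in> r - Id"
proof -
  have cc: "c \<in> carrier G" "c \<noteq> \<one>" using c r_carrier by auto
  have "\<exists>x. between \<one> c x \<and> x \<notin> generate G {c}"
  proof (rule gap_of_trivial_soul[OF soul _ _ cc])
    show "subgroup (generate G {c}) G" using cc by (intro generate_is_subgroup) simp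
    fix f g assume fg: "f \<in> generate G {c}" "g \<in> generate G {c}"
      "(\<one>, f) \<in> r - Id" "(\<one>, g) \<in> r - Id"
    have fgc: "f \<in> carrier G" "g \<in> carrier G" "f \<noteq> \<one>" using fg r_carrier by auto
    obtain i j :: int where "f = c [^] i" "g = c [^] j"
      using fg generate_pow[OF cc(1)] by auto
    then have comm: "f \<otimes> g = g \<otimes> f" using cc int_pow_mult[of c] by (metis add.commute)
    have "(g, g \<otimes> f) \<in> r" using r_left_iff[of g \<one> f] fg fgc by simp
    moreover have "g \<noteq> g \<otimes> f" using fgc by simp
    ultimately show "(g, f \<otimes> g) \<in> r - Id" unfolding comm by simp
  qed
  then obtain x where x: "between \<one> c x" "x \<notin> generate G {c}" by blast
  have "x \<noteq> \<one>" using x(2) generate.one by metis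
  moreover have "x \<noteq> c" using x(2) generate.incl by (metis singletonI)
  moreover have "(\<one>, x) \<in> r" "(x, c) \<in> r"
    using between_positive[OF _ x(1)] c by auto
  ultimately show ?thesis by blast
qed

section \<open>Conjugates of an ordering\<close>

text \<open>Since \<open>g\<close> is positive for the conjugate by \<open>h\<close> iff \<open>h \<prec> g \<otimes> h\<close>, this is the stabilizer of
  the ordering under conjugation.\<close>

definition ordering_stabilizer :: "'a set" where
  "ordering_stabilizer = {h \<in> carrier G. \<forall>g\<in>carrier G. (h, g \<otimes> h) \<in> r \<longleftrightarrow> (\<one>, g) \<in> r}"

lemma mem_conjugate_cone_iff:
  assumes h: "h \<in> carrier G" and g: "g \<in> carrier G"
  shows "g \<in> (h <# positive_cone G r) #> inv h \<longleftrightarrow> (h, g \<otimes> h) \<in> r - Id"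
proof -
  have "g \<in> (h <# positive_cone G r) #> inv h \<longleftrightarrow>
      (\<exists>p\<in>positive_cone G r. g = h \<otimes> p \<otimes> inv h)"
    unfolding l_coset_def r_coset_def by auto
  also have "\<dots> \<longleftrightarrow> (\<exists>p\<in>positive_cone G r. p = inv h \<otimes> (g \<otimes> h))"
  proof (rule bex_cong[OF refl])
    fix p assume "p \<in> positive_cone G r"
    then have "p \<in> carrier G" using r_carrier unfolding positive_cone_def by blast
    then show "g = h \<otimes> p \<otimes> inv h \<longleftrightarrow> p = inv h \<otimes> (g \<otimes> h)"
      using h g by (auto simp: inv_solve_right inv_solve_left)
  qed
  also have "\<dots> \<longleftrightarrow> inv h \<otimes> (g \<otimes> h) \<in> positive_cone G r" by blast
  also have "\<dots> \<longleftrightarrow> (h, g \<otimes> h) \<in> r - Id"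
  proof -
    have "inv h \<otimes> (g \<otimes> h) = \<one> \<longleftrightarrow> h = g \<otimes> h"
      using h g inv_solve_left'[of "\<one>" h "g \<otimes> h"] by auto
    moreover have "(\<one>, inv h \<otimes> (g \<otimes> h)) \<in> r \<longleftrightarrow> (h, g \<otimes> h) \<in> r"
      using r_left_iff[of "inv h" h "g \<otimes> h"] h g by simp
    ultimately show ?thesis unfolding positive_cone_def by auto
  qed
  finally show ?thesis .
qed

lemma subgroup_ordering_stabilizer: "subgroup ordering_stabilizer G"
proof (rule subgroupI)
  show "ordering_stabilizer \<subseteq> carrier G" unfolding ordering_stabilizer_def by blast
  have "\<one> \<in> ordering_stabilizer" unfolding ordering_stabilizer_def by simp
  then show "ordering_stabilizer \<noteq> {}" by blast
  fix a assume a: "a \<in> ordering_stabilizer"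
  then have ac: "a \<in> carrier G" unfolding ordering_stabilizer_def by simp
  have stab_a: "(a, g \<otimes> a) \<in> r \<longleftrightarrow> (\<one>, g) \<in> r" if "g \<in> carrier G" for g
    using a that unfolding ordering_stabilizer_def by blast
  have "(inv a, g \<otimes> inv a) \<in> r \<longleftrightarrow> (\<one>, g) \<in> r" if g: "g \<in> carrier G" for g
  proof -
    have "(inv a, g \<otimes> inv a) \<in> r \<longleftrightarrow> (\<one>, a \<otimes> g \<otimes> inv a) \<in> r"
      using r_left_iff[of a "inv a" "g \<otimes> inv a"] ac g by (simp add: m_assoc)
    also have "\<dots> \<longleftrightarrow> (a, a \<otimes> g) \<in> r"
      using stab_a[of "a \<otimes> g \<otimes> inv a"] ac g by (simp add: m_assoc)
    also have "\<dots> \<longleftrightarrow> (\<one>, g) \<in> r"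
      using r_left_iff[of a \<one> g] ac g by simp
    finally show ?thesis .
  qed
  then show "inv a \<in> ordering_stabilizer" unfolding ordering_stabilizer_def using ac by simp
  fix b assume b: "b \<in> ordering_stabilizer"
  then have bc: "b \<in> carrier G" unfolding ordering_stabilizer_def by simp
  have stab_b: "(b, g \<otimes> b) \<in> r \<longleftrightarrow> (\<one>, g) \<in> r" if "g \<in> carrier G" for g
    using b that unfolding ordering_stabilizer_def by blast
  have "(a \<otimes> b, g \<otimes> (a \<otimes> b)) \<in> r \<longleftrightarrow> (\<one>, g) \<in> r" if g: "g \<in> carrier G" for g
  proof -
    have cancel: "a \<otimes> (inv a \<otimes> x) = x" if "x \<in> carrier G" for x
      using ac that by (simp add: m_assoc[symmetric])
    let ?k = "inv a \<otimes> (g \<otimes> a)"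
    have k: "?k \<in> carrier G" using ac g by simp
    have "a \<otimes> (?k \<otimes> b) = a \<otimes> ?k \<otimes> b" using ac k bc by (simp only: m_assoc)
    also have "\<dots> = g \<otimes> (a \<otimes> b)" using ac bc g cancel[of "g \<otimes> a"] by (simp add: m_assoc)
    finally have "(a \<otimes> b, g \<otimes> (a \<otimes> b)) \<in> r \<longleftrightarrow> (b, ?k \<otimes> b) \<in> r"
      using r_left_iff[of a b "?k \<otimes> b"] ac bc k by simp
    also have "\<dots> \<longleftrightarrow> (\<one>, ?k) \<in> r" using stab_b k by simp
    also have "\<dots> \<longleftrightarrow> (a, g \<otimes> a) \<in> r"
      using r_left_iff[of a \<one> ?k] ac g k cancel[of "g \<otimes> a"] by simp
    also have "\<dots> \<longleftrightarrow> (\<one>, g) \<in> r" using stab_a g by simp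
    finally show ?thesis .
  qed
  then show "a \<otimes> b \<in> ordering_stabilizer" unfolding ordering_stabilizer_def using ac bc by simp
qed

lemma nontrivial_conjugate:
  assumes soul: "conradian_soul G r = {\<one>}" and c: "(\<one>, c) \<in> r - Id"
  shows "\<exists>h. (\<one>, h) \<in> r \<and> (h, c) \<in> r - Id \<and> h \<notin> ordering_stabilizer"
proof -
  obtain d where d: "(\<one>, d) \<in> r - Id" "(d, c) \<in> r - Id"
    using no_least_positive[OF soul c] by blast
  have dc: "d \<in> carrier G" "d \<noteq> \<one>" using d r_carrier by auto
  have "\<exists>x. between \<one> d x \<and> x \<notin> ordering_stabilizer"
  proof (rule gap_of_trivial_soul[OF soul subgroup_ordering_stabilizer _ dc])
    fix f g assume fg: "f \<in> ordering_stabilizer" "g \<in> ordering_stabilizer"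
      "(\<one>, f) \<in> r - Id" "(\<one>, g) \<in> r - Id"
    then have "f \<in> carrier G" "g \<in> carrier G" "f \<noteq> \<one>" using r_carrier by auto
    then show "(g, f \<otimes> g) \<in> r - Id" using fg unfolding ordering_stabilizer_def by auto
  qed
  then obtain x where x: "between \<one> d x" "x \<notin> ordering_stabilizer" by blast
  have xd: "(\<one>, x) \<in> r" "(x, d) \<in> r" using between_positive[OF _ x(1)] d by auto
  have "(x, c) \<in> r" using r_trans[OF xd(2)] d by blast
  moreover have "x \<noteq> c" using xd(2) d r_antisym by blast
  ultimately show ?thesis using xd(1) x(2) by blast
qed

section \<open>Neighbourhoods of an ordering\<close>

text \<open>The sets of orderings making all \<open>f \<succeq> c\<close> positive shrink as \<open>c \<succ> \<one>\<close> decreases, so the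
  smaller of two bounds serves an intersection. The element \<open>p\<close> is the bound for the whole space.\<close>

lemma LO_neighbourhood:
  assumes p: "(\<one>, p) \<in> r - Id" and U: "openin (LO_topology G) U" "r \<in> U"
  shows "\<exists>c. (\<one>, c) \<in> r - Id \<and>
           (\<forall>s\<in>left_orderings G. (\<forall>f. (c, f) \<in> r \<longrightarrow> f \<in> positive_cone G s) \<longrightarrow> s \<in> U)"
proof -
  let ?B = "insert (left_orderings G)
     ((\<lambda>f. {s \<in> left_orderings G. f \<in> positive_cone G s}) ` (carrier G - {\<one>}))"
  have "generate_topology_on ?B U"
    using U(1) unfolding LO_topology_def openin_topology_generated_by_iff .
  then show ?thesis using U(2)
  proof (induction rule: generate_topology_on.induct)
    case Empty
    then show ?case by simp
  next
    case (Int A B)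
    obtain a where a: "(\<one>, a) \<in> r - Id"
      "\<forall>s\<in>left_orderings G. (\<forall>f. (a, f) \<in> r \<longrightarrow> f \<in> positive_cone G s) \<longrightarrow> s \<in> A"
      using Int by blast
    obtain b where b: "(\<one>, b) \<in> r - Id"
      "\<forall>s\<in>left_orderings G. (\<forall>f. (b, f) \<in> r \<longrightarrow> f \<in> positive_cone G s) \<longrightarrow> s \<in> B"
      using Int by blast
    have "a \<in> carrier G" "b \<in> carrier G" using a(1) b(1) r_carrier by auto
    then have "(a, b) \<in> r \<or> (b, a) \<in> r" by (rule r_total)
    then show ?case
    proof
      assume "(a, b) \<in> r"
      then have "(b, f) \<in> r \<Longrightarrow> (a, f) \<in> r" for f by (rule r_trans)
      then have "\<forall>s\<in>left_orderings G.
          (\<forall>f. (a, f) \<in> r \<longrightarrow> f \<in> positive_cone G s) \<longrightarrow> s \<in> A \<inter> B"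
        using a(2) b(2) by simp
      then show ?thesis using a(1) by blast
    next
      assume "(b, a) \<in> r"
      then have "(a, f) \<in> r \<Longrightarrow> (b, f) \<in> r" for f by (rule r_trans)
      then have "\<forall>s\<in>left_orderings G.
          (\<forall>f. (b, f) \<in> r \<longrightarrow> f \<in> positive_cone G s) \<longrightarrow> s \<in> A \<inter> B"
        using a(2) b(2) by simp
      then show ?thesis using b(1) by blast
    qed
  next
    case (UN K)
    then obtain A where "A \<in> K" "r \<in> A" by blast
    then show ?case using UN.IH by blast
  next
    case (Basis A)
    then consider "A = left_orderings G"
      | f where "f \<in> carrier G" "A = {s \<in> left_orderings G. f \<in> positive_cone G s}" by blast
    then show ?case
    proof cases
      case 1
      then show ?thesis using p by blast
    next
      case 2
      then have "(\<one>, f) \<in> r - Id" using Basis(2) unfolding positive_cone_def by blast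
      then show ?thesis using 2 r_refl by blast
    qed
  qed
qed

end

theorem theorem2p7:
  fixes G :: "('a, 'b) monoid_scheme" and r :: "'a rel"
  assumes "ordered_group G r"
    and "conradian_soul G r = {\<one>\<^bsub>G\<^esub>}"
    and "\<not> conradian G r"
  shows "r \<in> LO_topology G derived_set_of conjugates G r"
proof -
  interpret ordered_group G r by (rule assms(1))
  obtain p where p: "(\<one>\<^bsub>G\<^esub>, p) \<in> r - Id"
    using assms(3) unfolding conradian_def positive_cone_def by blast
  show ?thesis
    unfolding in_derived_set_of topspace_LO_topology
  proof (intro conjI allI impI ordering)
    fix U assume U: "r \<in> U \<and> openin (LO_topology G) U"
    obtain c where c: "(\<one>\<^bsub>G\<^esub>, c) \<in> r - Id"
      "\<forall>s\<in>left_orderings G. (\<forall>f. (c, f) \<in> r \<longrightarrow> f \<in> positive_cone G s) \<longrightarrow> s \<in> U"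
      using LO_neighbourhood[OF p] U by blast
    obtain h where h: "(\<one>\<^bsub>G\<^esub>, h) \<in> r" "(h, c) \<in> r - Id" "h \<notin> ordering_stabilizer"
      using nontrivial_conjugate[OF assms(2) c(1)] by blast
    have hc: "h \<in> carrier G" using h r_carrier by blast
    obtain s where s: "s \<in> left_orderings G"
      "positive_cone G s = (h <#\<^bsub>G\<^esub> positive_cone G r) #>\<^bsub>G\<^esub> (inv\<^bsub>G\<^esub> h)"
      using ex_conjugate[OF hc] by blast
    have "f \<in> positive_cone G s" if f: "(c, f) \<in> r" for f
    proof -
      have fc: "f \<in> carrier G" using f r_carrier by blast
      have "(f, f \<otimes>\<^bsub>G\<^esub> h) \<in> r" using r_left[OF fc h(1)] fc by simp
      then have "(c, f \<otimes>\<^bsub>G\<^esub> h) \<in> r" using r_trans[OF f] by blast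
      then have "(h, f \<otimes>\<^bsub>G\<^esub> h) \<in> r - Id" using h(2) r_strict_trans by blast
      then show ?thesis using s(2) mem_conjugate_cone_iff[OF hc fc] by simp
    qed
    then have "s \<in> U" using c(2) s(1) by blast
    moreover have "s \<in> conjugates G r" using s hc unfolding conjugates_def by blast
    moreover have "s \<noteq> r"
    proof
      assume "s = r"
      then have "(h, g \<otimes>\<^bsub>G\<^esub> h) \<in> r - Id \<longleftrightarrow> (\<one>\<^bsub>G\<^esub>, g) \<in> r - Id" if "g \<in> carrier G" for g
        using mem_conjugate_cone_iff[OF hc that] s(2) unfolding positive_cone_def by auto
      moreover have "h = g \<otimes>\<^bsub>G\<^esub> h \<longleftrightarrow> \<one>\<^bsub>G\<^esub> = g" if "g \<in> carrier G" for g
        using hc that by auto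
      ultimately have "(h, g \<otimes>\<^bsub>G\<^esub> h) \<in> r \<longleftrightarrow> (\<one>\<^bsub>G\<^esub>, g) \<in> r" if "g \<in> carrier G" for g
        using that hc r_refl by (cases "g = \<one>\<^bsub>G\<^esub>") auto
      then have "h \<in> ordering_stabilizer"
        using hc unfolding ordering_stabilizer_def by simp
      then show False using h(3) by simp
    qed
    ultimately show "\<exists>y. y \<noteq> r \<and> y \<in> conjugates G r \<and> y \<in> U" by blast
  qed
qed

end
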